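(* Let $([0,1],\mathscr{B},\mu,T)$ be a measure preserving system. Suppose that for every $f \in L^{\infty}([0,1],\mu)$ with $\int_{[0,1]} f\,d\mu = 0$ there exists a set $A_f \subseteq [0,1]$ satisfying $\mu(A_f)=1$ such that for every $x\in A_f$ the sequence $\left(f(T^n x)\right)_{n=1}^{\infty}$ is a strongly mixing sequence. Then $T$ is strongly mixing.
   Context: A measure preserving system (m.p.s.) $(X,\mathscr{B},\mu,T)$ consists of a set $X$, a $\sigma$-algebra $\mathscr{B}$ of subsets of $X$, a probability measure $\mu$ on $(X,\mathscr{B})$ and a measurable transformation $T:X\to X$ with $\mu(A)=\mu(T^{-1}A)$ for all $A\in\mathscr{B}$. For systems on $X=[0,1]$, $\mathscr{B}$ is assumed to be the completion (with respect to $\mu$) of the Borel $\sigma$-algebra. Functions are complex-valued and $\mathbb{N}=\{1,2,3,\dots\}$. $T$ (equivalently the m.p.s. $(X,\mathscr{B},\mu,T)$) is strongly mixing if for every $A,B\in\mathscr{B}$, $\lim_{n\to\infty}\mu(A\cap T^{-n}B)=\mu(A)\mu(B)$. Strongly mixing sequence: let $(x_n)_{n=1}^\infty\subseteq\mathbb{C}$ satisfy $\limsup_{N\to\infty}\frac1N\sum_{n=1}^N|x_n|<\infty$. Then $(x_n)_{n=1}^\infty$ is a strongly mixing sequence if the following holds: whenever $(y_n)_{n=1}^\infty\subseteq\mathbb{C}$ is a bounded sequence and $(N_q)_{q=1}^\infty\subseteq\mathbb{N}$ is a strictly increasing sequence such that $\ell(h):=\lim_{q\to\infty}\frac{1}{N_q}\sum_{n=1}^{N_q}x_{n+h}\overline{y_n}$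 exists for every $h\in\mathbb{N}$, we have $\lim_{h\to\infty}|\ell(h)|=0$. *)

theory Defs
  imports "HOL-Probability.Probability"
begin

locale mps = prob_space M for M :: "'a measure" +
  fixes T :: "'a \<Rightarrow> 'a"
  assumes measurable_T: "T \<in> M \<rightarrow>\<^sub>M M"
    and preserves_measure: "\<And>A. A \<in> sets M \<Longrightarrow> measure M (T -` A \<inter> space M) = measure M A"

definition strongly_mixing :: "'a measure \<Rightarrow> ('a \<Rightarrow> 'a) \<Rightarrow> bool" where
  "strongly_mixing M T \<longleftrightarrow>
    (\<forall>A \<in> sets M. \<forall>B \<in> sets M.
      (\<lambda>n. measure M (A \<inter> ((T ^^ n) -` B \<inter> space M))) \<longlonglongrightarrow> measure M A * measure M B)"

(* Representatives of the elements of L^infinity, not equivalence classes. *)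
definition L_infinity :: "'a measure \<Rightarrow> ('a \<Rightarrow> complex) set" where
  "L_infinity M = {f \<in> borel_measurable M. esssup M (\<lambda>x. ereal (norm (f x))) < \<infinity>}"

(* All sequences are indexed by 1, 2, 3, ...; the values of x, y, Nq and l at 0 are irrelevant.
   The limit superior is taken in the extended reals, so that it always exists. *)
definition strongly_mixing_sequence :: "(nat \<Rightarrow> complex) \<Rightarrow> bool" where
  "strongly_mixing_sequence x \<longleftrightarrow>
    limsup (\<lambda>N. ereal (1 / real N * (\<Sum>n=1..N. norm (x n)))) < \<infinity> \<and>
    (\<forall>(y :: nat \<Rightarrow> complex) (Nq :: nat \<Rightarrow> nat) (l :: nat \<Rightarrow> complex).
      bounded (y ` {1..}) \<longrightarrow>
      Nq ` {1..} \<subseteq> {1..} \<longrightarrow> strict_mono_on {1..} Nq \<longrightarrow>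
      (\<forall>h\<ge>1. (\<lambda>q. 1 / of_nat (Nq q) * (\<Sum>n=1..Nq q. x (n + h) * cnj (y n))) \<longlonglongrightarrow> l h) \<longrightarrow>
      (\<lambda>h. norm (l h)) \<longlonglongrightarrow> 0)"

end

theory Submission
  imports Defs
begin

text \<open>
  Fix measurable sets \<open>A\<close> and \<open>B\<close>, and put \<open>f = 1\<^sub>B - \<mu>(B)\<close>, \<open>g = 1\<^sub>A\<close> and
  \<open>F\<^sub>h(x) = f(T\<^sup>h x) g(x)\<close>. The correlation \<open>\<mu>(A \<inter> T\<^sup>-\<^sup>h B) - \<mu>(A) \<mu>(B)\<close> is the integral of
  \<open>F\<^sub>h\<close>, so it has to be shown that these integrals tend to \<open>0\<close>.

  Test the strongly mixing sequence \<open>f(T\<^sup>n x)\<close> against the bounded sequence \<open>y\<^sub>n = g(T\<^sup>n x)\<close>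
  taken from the same orbit: the averages of \<open>f(T\<^bsup>n+h\<^esup> x) y\<^sub>n\<close> are the ergodic averages of
  \<open>F\<^sub>h\<close> at \<open>x\<close>. If, along one sequence \<open>N\<^sub>q\<close> that serves all \<open>h\<close> and almost all \<open>x\<close>, these
  averages converge to some \<open>l\<^sub>h(x)\<close>, then the hypothesis gives \<open>l\<^sub>h(x) \<longlonglongrightarrow> 0\<close> as
  \<open>h\<close> grows, for almost every \<open>x\<close>. Every ergodic average of \<open>F\<^sub>h\<close> has the same integral as
  \<open>F\<^sub>h\<close>, hence by dominated convergence so has \<open>l\<^sub>h\<close>; dominated convergence once more, now
  in \<open>h\<close>, shows that the integrals of \<open>F\<^sub>h\<close> tend to \<open>0\<close>. This is \<open>correlations_tendsto_0\<close>.

  Since the definition of a strongly mixing sequence allows averaging along a subsequence, the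
  pointwise ergodic theorem can be bypassed: the mean ergodic theorem makes the averages of each
  \<open>F\<^sub>h\<close> Cauchy in \<open>L\<^sup>2\<close> (\<open>mean_ergodic_Cauchy\<close>), and a sufficiently sparse sequence then gives
  almost everywhere convergence for all \<open>h\<close> at once
  (\<open>ergodic_averages_AE_convergent_subsequence\<close>).
\<close>

section \<open>Iterates of a measure preserving map\<close>

context mps
begin

lemma measurable_iterate [measurable]: "T ^^ n \<in> M \<rightarrow>\<^sub>M M"
  by (rule measurable_compose_n) (rule measurable_T)

lemma distr_T: "distr M M T = M"
proof (rule measure_eqI)
  fix A assume "A \<in> sets (distr M M T)"
  then have A: "A \<in> sets M" by simp
  then show "emeasure (distr M M T) A = emeasure M A"
    using measurable_T preserves_measure[OF A] by (simp add: emeasure_distr emeasure_eq_measure)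
qed simp

lemma integral_iterate:
  fixes F :: "'a \<Rightarrow> real"
  assumes [measurable]: "F \<in> borel_measurable M"
  shows "(LINT x|M. F ((T ^^ n) x)) = (LINT x|M. F x)"
proof (induction n)
  case (Suc n)
  have "(LINT x|M. F ((T ^^ n) x)) = (LINT x|distr M M T. F ((T ^^ n) x))"
    by (simp add: distr_T)
  also have "\<dots> = (LINT x|M. F ((T ^^ n) (T x)))"
    using measurable_T measurable_compose[OF measurable_iterate assms]
    by (intro integral_distr)
  finally show ?case using Suc by (simp add: funpow_swap1)
qed simp

end

section \<open>Ergodic averages\<close>

definition ergodic_average :: "('a \<Rightarrow> 'a) \<Rightarrow> nat \<Rightarrow> ('a \<Rightarrow> real) \<Rightarrow> 'a \<Rightarrow> real" where
  "ergodic_average T N F x = (\<Sum>n=1..N. F ((T ^^ n) x)) / real N"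

lemma abs_ergodic_average_le:
  assumes "\<And>x. \<bar>F x\<bar> \<le> K"
  shows "\<bar>ergodic_average T N F x\<bar> \<le> K"
proof (cases "N = 0")
  case True
  have "0 \<le> \<bar>F x\<bar>" by simp
  then have "0 \<le> K" using assms[of x] by linarith
  then show ?thesis using True by (simp add: ergodic_average_def)
next
  case False
  have "\<bar>\<Sum>n=1..N. F ((T ^^ n) x)\<bar> \<le> (\<Sum>n=1..N. \<bar>F ((T ^^ n) x)\<bar>)" by (rule sum_abs)
  also have "\<dots> \<le> of_nat (card {1..N}) * K" by (rule sum_bounded_above) (use assms in auto)
  finally show ?thesis using False by (simp add: ergodic_average_def field_simps)
qed

text \<open>
  Replacing \<open>F\<close> by \<open>F \<circ> T\<close> shifts the window \<open>1, \<dots>, N\<close> by one, which changes only two of the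
  summands; \<open>F \<circ> T\<^sup>i\<close> takes \<open>i\<close> such steps.
\<close>
lemma ergodic_average_iterate_le:
  assumes "\<And>x. \<bar>F x\<bar> \<le> K"
  shows "\<bar>ergodic_average T N (\<lambda>x. F ((T ^^ i) x)) x - ergodic_average T N F x\<bar> \<le> 2 * i * K / N"
proof (induction i)
  case (Suc i)
  let ?u = "\<lambda>n. F ((T ^^ (n + i)) x)"
  have step: "ergodic_average T N (\<lambda>x. F ((T ^^ Suc i) x)) x - ergodic_average T N (\<lambda>x. F ((T ^^ i) x)) x
      = (?u (Suc N) - ?u 1) / N"
  proof -
    have "(\<Sum>n=1..N. ?u (Suc n) - ?u n) = ?u (Suc N) - ?u 1"
      by (rule sum_Suc_diff) simp
    then show ?thesis
      unfolding ergodic_average_def diff_divide_distrib[symmetric] sum_subtractf[symmetric]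
      by (simp flip: funpow_add[unfolded fun_eq_iff comp_def, rule_format] add: ac_simps)
  qed
  have "\<bar>(?u (Suc N) - ?u 1) / N\<bar> \<le> 2 * K / N"
    unfolding abs_divide using assms[of "(T ^^ (Suc N + i)) x"] assms[of "(T ^^ (1 + i)) x"]
    by (auto intro!: divide_right_mono)
  moreover have "2 * real (Suc i) * K / N = 2 * i * K / N + 2 * K / N"
    by (simp add: algebra_simps add_divide_distrib)
  ultimately show ?case using Suc step by linarith
qed simp

text \<open>
  An average of \<open>F\<close> is a convex combination of iterates \<open>F \<circ> T\<^sup>i\<close>, so averaging it again over a
  long window gives nearly the same as averaging \<open>F\<close>.
\<close>
lemma ergodic_average_average_le:
  assumes "\<And>x. \<bar>F x\<bar> \<le> K" "m \<ge> 1"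
  shows "\<bar>ergodic_average T N (ergodic_average T m F) x - ergodic_average T N F x\<bar> \<le> 2 * m * K / N"
proof -
  have K: "0 \<le> K" using assms(1)[of x] abs_ge_zero[of "F x"] by linarith
  let ?d = "\<lambda>i. ergodic_average T N (\<lambda>x. F ((T ^^ i) x)) x - ergodic_average T N F x"
  have "ergodic_average T N (ergodic_average T m F) x
      = (\<Sum>i=1..m. ergodic_average T N (\<lambda>x. F ((T ^^ i) x)) x) / m"
    unfolding ergodic_average_def sum_divide_distrib
    by (subst sum.swap) (simp add: mult.commute)
  then have eq: "ergodic_average T N (ergodic_average T m F) x - ergodic_average T N F x
      = (\<Sum>i=1..m. ?d i) / m"
    using assms(2) by (simp add: sum_subtractf diff_divide_distrib)
  have "\<bar>\<Sum>i=1..m. ?d i\<bar> \<le> (\<Sum>i=1..m. \<bar>?d i\<bar>)" by (rule sum_abs)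
  also have "\<dots> \<le> of_nat (card {1..m}) * (2 * m * K / N)"
  proof (rule sum_bounded_above)
    fix i assume "i \<in> {1..m}"
    then have "2 * i * K / N \<le> 2 * m * K / N"
      using K by (intro divide_right_mono mult_right_mono) auto
    then show "\<bar>?d i\<bar> \<le> 2 * m * K / N"
      using ergodic_average_iterate_le[of F K T N i x, OF assms(1)] by simp
  qed
  finally show ?thesis using assms(2) unfolding eq abs_divide by (simp add: field_simps)
qed

section \<open>The mean ergodic theorem\<close>

context mps
begin

lemma borel_measurable_ergodic_average [measurable]:
  assumes [measurable]: "F \<in> borel_measurable M"
  shows "ergodic_average T N F \<in> borel_measurable M"
  unfolding ergodic_average_def[abs_def] by measurable

lemma integrable_bounded:
  fixes F :: "'a \<Rightarrow> real"
  assumes "F \<in> borel_measurable M" "\<And>x. \<bar>F x\<bar> \<le> K"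
  shows "integrable M F"
  by (rule integrable_const_bound[where B = K]) (use assms in auto)

lemma integrable_square_bounded:
  fixes F :: "'a \<Rightarrow> real"
  assumes [measurable]: "F \<in> borel_measurable M" and b: "\<And>x. \<bar>F x\<bar> \<le> K"
  shows "integrable M (\<lambda>x. (F x)\<^sup>2)"
proof (rule integrable_bounded)
  show "\<bar>(F x)\<^sup>2\<bar> \<le> K\<^sup>2" for x
    using power_mono[OF b[of x], of 2] by simp
qed measurable

lemma integral_ergodic_average:
  assumes [measurable]: "F \<in> borel_measurable M" and b: "\<And>x. \<bar>F x\<bar> \<le> K" and "N \<ge> 1"
  shows "(LINT x|M. ergodic_average T N F x) = (LINT x|M. F x)"
proof -
  have "integrable M (\<lambda>x. F ((T ^^ n) x))" for n
    by (rule integrable_bounded) (use b in auto)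
  then show ?thesis
    using assms(3) by (simp add: ergodic_average_def integral_iterate)
qed

text \<open>
  Averaging is a contraction in \<open>L\<^sup>2\<close>: by Cauchy--Schwarz the square of an average is at most the
  average of the squares, and averaging preserves integrals.
\<close>
lemma integral_square_ergodic_average_le:
  assumes [measurable]: "F \<in> borel_measurable M" and b: "\<And>x. \<bar>F x\<bar> \<le> K" and "N \<ge> 1"
  shows "(LINT x|M. (ergodic_average T N F x)\<^sup>2) \<le> (LINT x|M. (F x)\<^sup>2)"
proof -
  have b2: "\<bar>(F x)\<^sup>2\<bar> \<le> K\<^sup>2" for x
    using power_mono[OF b[of x], of 2] by simp
  have "(ergodic_average T N F x)\<^sup>2 \<le> ergodic_average T N (\<lambda>x. (F x)\<^sup>2) x" for x
  proof -
    have "(\<Sum>n=1..N. 1 * F ((T ^^ n) x))\<^sup>2 \<le> (\<Sum>n=1..N. 1\<^sup>2) * (\<Sum>n=1..N. (F ((T ^^ n) x))\<^sup>2)"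
      by (rule Cauchy_Schwarz_ineq_sum)
    then show ?thesis
      using assms(3) by (simp add: ergodic_average_def power_divide field_simps power2_eq_square)
  qed
  then have "(LINT x|M. (ergodic_average T N F x)\<^sup>2) \<le> (LINT x|M. ergodic_average T N (\<lambda>x. (F x)\<^sup>2) x)"
    by (intro integral_mono integrable_square_bounded[where K = K] integrable_bounded[where K = "K\<^sup>2"]
        abs_ergodic_average_le b b2) measurable
  also have "\<dots> = (LINT x|M. (F x)\<^sup>2)"
    by (rule integral_ergodic_average[where K = "K\<^sup>2"]) (use b2 assms in auto)
  finally show ?thesis .
qed

text \<open>
  In \<open>mean_ergodic_Cauchy\<close>, \<open>G\<close> is a convex combination of iterates of \<open>F\<close>. The bound says that
  such a \<open>G\<close> has, up to an error that vanishes with \<open>N\<close>, at least the \<open>L\<^sup>2\<close> norm of a long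
  average of \<open>F\<close>: the averages of \<open>F\<close> and \<open>G\<close> nearly agree, and averaging \<open>G\<close> does not increase
  its norm.
\<close>
lemma integral_square_ergodic_average_le_asymptotic:
  assumes [measurable]: "F \<in> borel_measurable M" "G \<in> borel_measurable M"
    and F: "\<And>x. \<bar>F x\<bar> \<le> K" and G: "\<And>x. \<bar>G x\<bar> \<le> K"
    and close: "\<And>x. \<bar>ergodic_average T N G x - ergodic_average T N F x\<bar> \<le> C / N"
    and "N \<ge> 1"
  shows "(LINT x|M. (ergodic_average T N F x)\<^sup>2) \<le> (LINT x|M. (G x)\<^sup>2) + 2 * K * C / N"
proof -
  let ?F = "ergodic_average T N F" and ?G = "ergodic_average T N G"
  have "(?F x)\<^sup>2 \<le> (?G x)\<^sup>2 + 2 * K * C / N" for x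
  proof -
    have "(?F x)\<^sup>2 - (?G x)\<^sup>2 = (?F x + ?G x) * (?F x - ?G x)"
      by (simp add: algebra_simps power2_eq_square)
    also have "\<dots> \<le> \<bar>?F x + ?G x\<bar> * \<bar>?F x - ?G x\<bar>"
      by (metis abs_ge_self abs_mult)
    also have "\<dots> \<le> (2 * K) * (C / N)"
      using abs_ergodic_average_le[of F K T N x, OF F] abs_ergodic_average_le[of G K T N x, OF G] close[of x]
      by (intro mult_mono) linarith+
    finally show ?thesis by simp
  qed
  then have "(LINT x|M. (?F x)\<^sup>2) \<le> (LINT x|M. (?G x)\<^sup>2 + 2 * K * C / N)"
    by (intro integral_mono Bochner_Integration.integrable_add integrable_square_bounded[where K = K]
        abs_ergodic_average_le F G) auto
  also have "\<dots> = (LINT x|M. (?G x)\<^sup>2) + 2 * K * C / N"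
    using integrable_square_bounded[of ?G K] abs_ergodic_average_le[of G K T N, OF G] by (simp add: prob_space)
  also have "\<dots> \<le> (LINT x|M. (G x)\<^sup>2) + 2 * K * C / N"
    using integral_square_ergodic_average_le[of G K N] G assms by simp
  finally show ?thesis .
qed

text \<open>
  Let \<open>c\<close> be the infimum of the squared \<open>L\<^sup>2\<close> norms of the averages of \<open>F\<close>. By the previous
  lemma, used with one nearly optimal average as \<open>G\<close>, all long averages are nearly optimal;
  used with a midpoint of two averages as \<open>G\<close>, it shows that the squared norm of the midpoint is
  still at least \<open>c\<close>. The parallelogram law then forces long averages to be close to each other.
\<close>
lemma mean_ergodic_Cauchy:
  assumes [measurable]: "F \<in> borel_measurable M" and b: "\<And>x. \<bar>F x\<bar> \<le> K" and "e > 0"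
  obtains N0 where "\<And>m n. m \<ge> N0 \<Longrightarrow> n \<ge> N0 \<Longrightarrow>
    (LINT x|M. (ergodic_average T m F x - ergodic_average T n F x)\<^sup>2) < e"
proof -
  let ?A = "\<lambda>n. ergodic_average T n F"
  define a where "a n = (LINT x|M. (?A n x)\<^sup>2)" for n
  define c where "c = Inf (a ` {1..})"
  have bA: "\<bar>?A n x\<bar> \<le> K" for n x by (rule abs_ergodic_average_le) (rule b)
  have int: "integrable M (\<lambda>x. (?A n x)\<^sup>2)" for n
    by (rule integrable_square_bounded[OF _ bA]) measurable
  have "bdd_below (a ` {1..})"
    by (rule bdd_belowI[of _ 0]) (auto simp: a_def)
  then have c_le: "c \<le> a n" if "n \<ge> 1" for n
    using that unfolding c_def by (auto intro: cInf_lower)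
  have lim_C: "(\<lambda>N. 2 * K * C / real N) \<longlonglongrightarrow> 0" for C
    using tendsto_mult[OF tendsto_const[of "2 * K * C"] lim_1_over_n] by simp
  \<comment> \<open>A midpoint need not be an average of \<open>F\<close> over a window, but averages of the midpoint over
      long windows are close to those of \<open>F\<close>.\<close>
  have c_le_mid: "c \<le> (LINT x|M. ((?A m x + ?A n x) / 2)\<^sup>2)" if mn: "m \<ge> 1" "n \<ge> 1" for m n
  proof -
    let ?G = "\<lambda>x. (?A m x + ?A n x) / 2"
    have G: "\<bar>?G x\<bar> \<le> K" for x
      using bA[of m x] bA[of n x] by (simp add: abs_le_iff field_simps)
    have close: "\<bar>ergodic_average T N ?G x - ?A N x\<bar> \<le> (real m + real n) * K / N" for N x
    proof -
      let ?p = "ergodic_average T N (?A m) x - ?A N x" and ?q = "ergodic_average T N (?A n) x - ?A N x"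
      have "ergodic_average T N ?G x = (ergodic_average T N (?A m) x + ergodic_average T N (?A n) x) / 2"
        unfolding ergodic_average_def[of T N]
        by (simp add: sum.distrib flip: sum_divide_distrib add_divide_distrib)
      then have "ergodic_average T N ?G x - ?A N x = (?p + ?q) / 2"
        by (simp add: field_simps)
      then have "\<bar>ergodic_average T N ?G x - ?A N x\<bar> = \<bar>?p + ?q\<bar> / 2"
        by (simp only: abs_divide abs_numeral)
      also have "\<dots> \<le> (2 * m * K / N + 2 * n * K / N) / 2"
      proof (rule divide_right_mono)
        show "\<bar>?p + ?q\<bar> \<le> 2 * m * K / N + 2 * n * K / N"
          using abs_triangle_ineq[of ?p ?q] ergodic_average_average_le[of F K m T N x, OF b mn(1)]
            ergodic_average_average_le[of F K n T N x, OF b mn(2)] by linarith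
      qed simp
      also have "\<dots> = (real m + real n) * K / N"
        by (simp add: algebra_simps add_divide_distrib)
      finally show ?thesis .
    qed
    have "c \<le> (LINT x|M. (?G x)\<^sup>2) + 2 * K * ((real m + real n) * K) / real N" if "N \<ge> 1" for N
      using integral_square_ergodic_average_le_asymptotic[of F ?G K N, OF _ _ b G close that] c_le[OF that]
      by (simp add: a_def)
    moreover have "(\<lambda>N. (LINT x|M. (?G x)\<^sup>2) + 2 * K * ((real m + real n) * K) / N)
        \<longlonglongrightarrow> (LINT x|M. (?G x)\<^sup>2) + 0"
      by (intro tendsto_add tendsto_const lim_C)
    ultimately show ?thesis
      by (intro tendsto_lowerbound[where F = sequentially]) (auto simp: eventually_sequentially)
  qed
  have "c < c + e / 8" using \<open>e > 0\<close> by simp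
  then obtain m where m: "m \<ge> 1" "a m < c + e / 8"
    using cInf_lessD[of "a ` {1..}" "c + e / 8"] unfolding c_def by auto
  have "eventually (\<lambda>N. 2 * K * (2 * m * K) / real N < e / 8) sequentially"
    by (rule order_tendstoD(2)[OF lim_C]) (use \<open>e > 0\<close> in simp)
  then obtain N0 where N0: "\<And>N. N \<ge> N0 \<Longrightarrow> 2 * K * (2 * m * K) / real N < e / 8"
    by (auto simp: eventually_sequentially)
  have a_less: "a N < c + e / 4" if N: "N \<ge> max 1 N0" for N
  proof -
    have "a N \<le> a m + 2 * K * (2 * m * K) / N"
      unfolding a_def
      by (rule integral_square_ergodic_average_le_asymptotic[of F "?A m"])
        (use N m b bA ergodic_average_average_le[of F K m T N, OF b] in auto)
    then show ?thesis using N0[of N] N m by simp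
  qed
  show ?thesis
  proof
    fix m n assume mn: "m \<ge> max 1 N0" "n \<ge> max 1 N0"
    have int_mid: "integrable M (\<lambda>x. ((?A m x + ?A n x) / 2)\<^sup>2)"
    proof (rule integrable_square_bounded)
      show "\<bar>(?A m x + ?A n x) / 2\<bar> \<le> K" for x
        using bA[of m x] bA[of n x] by (simp add: abs_le_iff field_simps)
    qed measurable
    \<comment> \<open>The parallelogram law, with the sum of the two averages written as twice their midpoint.\<close>
    have "(LINT x|M. (?A m x - ?A n x)\<^sup>2)
        = (LINT x|M. 2 * (?A m x)\<^sup>2 + 2 * (?A n x)\<^sup>2 - 4 * ((?A m x + ?A n x) / 2)\<^sup>2)"
      by (intro Bochner_Integration.integral_cong refl)
        (simp add: power2_eq_square field_simps)
    also have "\<dots> = 2 * a m + 2 * a n - 4 * (LINT x|M. ((?A m x + ?A n x) / 2)\<^sup>2)"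
      unfolding a_def using int int_mid by simp
    also have "\<dots> < e"
      using a_less[OF mn(1)] a_less[OF mn(2)] c_le_mid[of m n] mn by simp
    finally show "(LINT x|M. (?A m x - ?A n x)\<^sup>2) < e" .
  qed
qed

lemma mean_ergodic_Cauchy_L1:
  assumes [measurable]: "F \<in> borel_measurable M" and b: "\<And>x. \<bar>F x\<bar> \<le> K" and "e > 0"
  obtains N0 where "\<And>m n. m \<ge> N0 \<Longrightarrow> n \<ge> N0 \<Longrightarrow>
    (LINT x|M. \<bar>ergodic_average T m F x - ergodic_average T n F x\<bar>) < e"
proof -
  obtain N0 where N0: "\<And>m n. m \<ge> N0 \<Longrightarrow> n \<ge> N0 \<Longrightarrow>
    (LINT x|M. (ergodic_average T m F x - ergodic_average T n F x)\<^sup>2) < e\<^sup>2"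
    using mean_ergodic_Cauchy[OF assms(1) b, of "e\<^sup>2"] \<open>e > 0\<close> by auto
  show ?thesis
  proof (rule that)
    fix m n assume mn: "m \<ge> N0" "n \<ge> N0"
    let ?u = "\<lambda>x. \<bar>ergodic_average T m F x - ergodic_average T n F x\<bar>"
    have u: "\<bar>?u x\<bar> \<le> 2 * K" for x
      using abs_ergodic_average_le[of F K T m x, OF b] abs_ergodic_average_le[of F K T n x, OF b] by linarith
    have "integrable M ?u" "integrable M (\<lambda>x. (?u x)\<^sup>2)"
      by (rule integrable_bounded[OF _ u] integrable_square_bounded[OF _ u]; measurable)+
    \<comment> \<open>A variance is nonnegative.\<close>
    then have "(expectation ?u)\<^sup>2 \<le> expectation (\<lambda>x. (?u x)\<^sup>2)"
      using variance_eq[of ?u] variance_positive[of ?u] by simp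
    also have "\<dots> < e\<^sup>2" using N0[OF mn] by simp
    finally show "expectation ?u < e"
      using \<open>e > 0\<close> by (simp add: power2_less_imp_less)
  qed
qed

end

section \<open>Almost everywhere convergence along a common subsequence\<close>

text \<open>
  By monotone convergence the sum of the absolute increments has finite integral, so it is finite
  almost everywhere and the increments form an absolutely convergent telescoping series there.
\<close>
lemma AE_convergent_of_summable_increments:
  fixes f :: "nat \<Rightarrow> 'a \<Rightarrow> real"
  assumes int: "\<And>q. integrable M (f q)"
    and sum: "summable (\<lambda>q. LINT x|M. \<bar>f (Suc q) x - f q x\<bar>)"
  shows "AE x in M. convergent (\<lambda>q. f q x)"
proof -
  let ?u = "\<lambda>q x. \<bar>f (Suc q) x - f q x\<bar>"
  have [measurable]: "f q \<in> borel_measurable M" for q using int by auto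
  have intu: "integrable M (?u q)" for q using int by auto
  have "(\<integral>\<^sup>+x. (\<Sum>q. ennreal (?u q x)) \<partial>M) = (\<Sum>q. \<integral>\<^sup>+x. ennreal (?u q x) \<partial>M)"
    by (rule nn_integral_suminf) measurable
  also have "\<dots> = (\<Sum>q. ennreal (LINT x|M. ?u q x))"
    using intu by (simp add: nn_integral_eq_integral)
  also have "\<dots> = ennreal (\<Sum>q. LINT x|M. ?u q x)"
    by (rule suminf_ennreal2) (use sum in auto)
  finally have "(\<integral>\<^sup>+x. (\<Sum>q. ennreal (?u q x)) \<partial>M) \<noteq> \<infinity>" by simp
  then have "AE x in M. (\<Sum>q. ennreal (?u q x)) \<noteq> \<infinity>"
    by (intro nn_integral_noteq_infinite) auto
  then show ?thesis
  proof eventually_elim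
    case (elim x)
    then have "summable (\<lambda>q. ?u q x)"
      by (intro summable_suminf_not_top) auto
    then have "summable (\<lambda>q. f (Suc q) x - f q x)"
      by (rule summable_rabs_cancel)
    then have "convergent (\<lambda>n. \<Sum>q<n. f (Suc q) x - f q x)"
      by (simp add: summable_iff_convergent)
    then have "convergent (\<lambda>n. f n x - f 0 x)"
      unfolding sum_lessThan_telescope[of "\<lambda>q. f q x"] .
    from convergent_add[OF this convergent_const[of "f 0 x"]] show ?case by simp
  qed
qed

context mps
begin

text \<open>
  One sequence serves all \<open>h\<close>: its \<open>q\<close>-th term is chosen beyond the point from which the
  averages of \<open>F\<^sub>0, \<dots>, F\<^sub>q\<close> differ by less than \<open>2\<^sup>-\<^sup>q\<close> in \<open>L\<^sup>1\<close>. For each \<open>h\<close> the increments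
  with \<open>q \<ge> h\<close> are then dominated by a geometric series.
\<close>
lemma ergodic_averages_AE_convergent_subsequence:
  fixes F :: "nat \<Rightarrow> 'a \<Rightarrow> real"
  assumes [measurable]: "\<And>h. F h \<in> borel_measurable M" and b: "\<And>h x. \<bar>F h x\<bar> \<le> K"
  obtains Nq :: "nat \<Rightarrow> nat" where "strict_mono Nq" "\<And>q. 1 \<le> Nq q"
    "AE x in M. \<forall>h. convergent (\<lambda>q. ergodic_average T (Nq q) (F h) x)"
proof -
  let ?d = "\<lambda>h m n. LINT x|M. \<bar>ergodic_average T m (F h) x - ergodic_average T n (F h) x\<bar>"
  have "\<exists>N0. \<forall>m\<ge>N0. \<forall>n\<ge>N0. ?d h m n < (1/2) ^ q" for h q
    by (rule mean_ergodic_Cauchy_L1[of "F h" K "(1/2) ^ q"]) (use b in auto)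
  then obtain R where R: "\<And>h q m n. m \<ge> R h q \<Longrightarrow> n \<ge> R h q \<Longrightarrow> ?d h m n < (1/2) ^ q"
    by metis
  \<comment> \<open>The sum dominates every \<open>R h q\<close> with \<open>h \<le> q\<close>; the summand \<open>q + 1\<close> makes \<open>Nq\<close> strictly
      increasing and positive.\<close>
  define Nq where "Nq q = q + 1 + (\<Sum>j\<le>q. \<Sum>h\<le>j. R h j)" for q
  have mono: "strict_mono Nq"
    by (rule strict_monoI_Suc) (simp add: Nq_def)
  have R_le: "R h q \<le> Nq q" if "h \<le> q" for h q
  proof -
    have "R h q \<le> (\<Sum>h\<le>q. R h q)" using that by (intro member_le_sum) auto
    also have "\<dots> \<le> (\<Sum>j\<le>q. \<Sum>h\<le>j. R h j)" by (intro member_le_sum) auto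
    finally show ?thesis by (simp add: Nq_def)
  qed
  have "AE x in M. convergent (\<lambda>q. ergodic_average T (Nq q) (F h) x)" for h
  proof (rule AE_convergent_of_summable_increments)
    show "integrable M (ergodic_average T (Nq q) (F h))" for q
      by (rule integrable_bounded[where K = K]) (auto intro: abs_ergodic_average_le b)
    show "summable (\<lambda>q. ?d h (Nq (Suc q)) (Nq q))"
    proof (rule summable_comparison_test')
      show "summable (\<lambda>q. (1/2::real) ^ q)" by simp
      show "norm (?d h (Nq (Suc q)) (Nq q)) \<le> (1/2) ^ q" if "q \<ge> h" for q
        using R[of h q "Nq (Suc q)" "Nq q"] R_le[OF that] strict_monoD[OF mono, of q "Suc q"]
        by simp
    qed
  qed
  then have "AE x in M. \<forall>h. convergent (\<lambda>q. ergodic_average T (Nq q) (F h) x)"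
    by (simp add: AE_all_countable)
  then show ?thesis using that[OF mono] by (simp add: Nq_def)
qed

section \<open>From orbits to the system\<close>

text \<open>
  Here the pointwise hypothesis is turned into a statement about integrals, by testing the orbit
  of \<open>f\<close> against the orbit of \<open>g\<close> through the same point.
\<close>
lemma correlations_tendsto_0:
  fixes f g :: "'a \<Rightarrow> real"
  assumes [measurable]: "f \<in> borel_measurable M" "g \<in> borel_measurable M"
    and f: "\<And>x. \<bar>f x\<bar> \<le> K" and g: "\<And>x. \<bar>g x\<bar> \<le> L"
    and mixing: "AE x in M. strongly_mixing_sequence (\<lambda>n. complex_of_real (f ((T ^^ n) x)))"
  shows "(\<lambda>h. LINT x|M. f ((T ^^ h) x) * g x) \<longlonglongrightarrow> 0"
proof -
  define F where "F h x = f ((T ^^ h) x) * g x" for h x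
  have [measurable]: "F h \<in> borel_measurable M" for h unfolding F_def[abs_def] by measurable
  have b: "\<bar>F h x\<bar> \<le> K * L" for h x
    unfolding F_def abs_mult using f[of x] g[of x] abs_ge_zero[of "f x"]
    by (intro mult_mono f g) linarith+
  obtain Nq where Nq: "strict_mono Nq" "\<And>q. 1 \<le> Nq q"
    and conv: "AE x in M. \<forall>h. convergent (\<lambda>q. ergodic_average T (Nq q) (F h) x)"
    using ergodic_averages_AE_convergent_subsequence[of F "K * L"] b by auto
  define l where "l h x = lim (\<lambda>q. ergodic_average T (Nq q) (F h) x)" for h x
  have [measurable]: "l h \<in> borel_measurable M" for h
    unfolding l_def[abs_def] by (rule borel_measurable_lim_metric) measurable
  have lim: "AE x in M. \<forall>h. (\<lambda>q. ergodic_average T (Nq q) (F h) x) \<longlonglongrightarrow> l h x"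
    using conv unfolding l_def by (auto simp: convergent_LIMSEQ_iff)
  have integral_l: "(LINT x|M. l h x) = (LINT x|M. F h x)" for h
  proof -
    have "(\<lambda>q. LINT x|M. ergodic_average T (Nq q) (F h) x) \<longlonglongrightarrow> (LINT x|M. l h x)"
      by (rule integral_dominated_convergence[where w = "\<lambda>_. K * L"])
        (use lim abs_ergodic_average_le[of "F h" "K * L"] b in auto)
    moreover have "(LINT x|M. ergodic_average T (Nq q) (F h) x) = (LINT x|M. F h x)" for q
      by (rule integral_ergodic_average) (use b Nq in auto)
    ultimately show ?thesis
      by (simp add: LIMSEQ_const_iff)
  qed
  have l_bound: "AE x in M. norm (l h x) \<le> K * L" for h
    using lim
  proof eventually_elim
    case (elim x)
    then have "(\<lambda>q. norm (ergodic_average T (Nq q) (F h) x)) \<longlonglongrightarrow> norm (l h x)"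
      by (intro tendsto_norm) simp
    then show ?case
      by (rule tendsto_upperbound) (auto intro!: always_eventually abs_ergodic_average_le b)
  qed
  have "AE x in M. (\<lambda>h. l h x) \<longlonglongrightarrow> 0"
    using lim mixing
  proof eventually_elim
    case (elim x)
    \<comment> \<open>The test sequence depends on \<open>x\<close>, but the averaging times \<open>Nq\<close> do not; this is what keeps
        the limits \<open>l h x\<close> measurable in \<open>x\<close>.\<close>
    let ?y = "\<lambda>n. complex_of_real (g ((T ^^ n) x))"
    have avg: "1 / of_nat N * (\<Sum>n=1..N. complex_of_real (f ((T ^^ (n + h)) x)) * cnj (?y n))
        = complex_of_real (ergodic_average T N (F h) x)" for N h
    proof -
      have "(T ^^ (n + h)) x = (T ^^ h) ((T ^^ n) x)" for n
        by (subst add.commute) (simp add: funpow_add)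
      then show ?thesis by (simp add: ergodic_average_def F_def)
    qed
    have "bounded (?y ` {1..})" by (rule boundedI[of _ L]) (use g in auto)
    moreover have "Nq ` {1..} \<subseteq> {1..}" using Nq(2) by auto
    moreover have "strict_mono_on {1..} Nq"
      using Nq(1) by (auto simp: strict_mono_on_def strict_mono_def)
    moreover have "(\<lambda>q. 1 / of_nat (Nq q) *
        (\<Sum>n=1..Nq q. complex_of_real (f ((T ^^ (n + h)) x)) * cnj (?y n)))
        \<longlonglongrightarrow> complex_of_real (l h x)" for h
      unfolding avg using elim(1) by (intro tendsto_of_real) simp
    ultimately have "(\<lambda>h. norm (complex_of_real (l h x))) \<longlonglongrightarrow> 0"
      using elim(2)[unfolded strongly_mixing_sequence_def, THEN conjunct2, rule_format,
          of ?y Nq "\<lambda>h. complex_of_real (l h x)"] by blast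
    then show ?case by (simp add: tendsto_rabs_zero_iff)
  qed
  then have "(\<lambda>h. LINT x|M. l h x) \<longlonglongrightarrow> (LINT x|M. 0)"
    by (intro integral_dominated_convergence[where w = "\<lambda>_. K * L"] l_bound) auto
  then show ?thesis by (simp add: integral_l F_def)
qed

lemma strongly_mixing_if_centred_indicators:
  assumes "\<And>B. B \<in> sets M \<Longrightarrow> AE x in M. strongly_mixing_sequence
      (\<lambda>n. complex_of_real (indicator B ((T ^^ n) x) - measure M B))"
  shows "strongly_mixing M T"
  unfolding strongly_mixing_def
proof (intro ballI)
  fix A B assume A [measurable]: "A \<in> sets M" and B [measurable]: "B \<in> sets M"
  let ?f = "\<lambda>x. indicator B x - measure M B :: real"
  let ?C = "\<lambda>n. measure M (A \<inter> ((T ^^ n) -` B \<inter> space M))"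
  have "(LINT x|M. ?f ((T ^^ n) x) * indicator A x) = ?C n - measure M A * measure M B" for n
  proof -
    have [measurable]: "(T ^^ n) -` B \<inter> space M \<in> sets M" by measurable
    have "(LINT x|M. ?f ((T ^^ n) x) * indicator A x)
        = (LINT x|M. indicator (A \<inter> ((T ^^ n) -` B \<inter> space M)) x - measure M B * indicator A x)"
      by (intro Bochner_Integration.integral_cong refl) (auto simp: indicator_def)
    also have "\<dots> = ?C n - measure M B * measure M A"
      by (subst Bochner_Integration.integral_diff)
        (auto simp: integrable_real_indicator emeasure_eq_measure)
    finally show ?thesis by simp
  qed
  moreover have "(\<lambda>n. LINT x|M. ?f ((T ^^ n) x) * indicator A x) \<longlonglongrightarrow> 0"
  proof (rule correlations_tendsto_0[where K = 1 and L = 1])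
    show "\<bar>?f x\<bar> \<le> 1" for x using prob_le_1[of B] measure_nonneg[of M B] by (cases "x \<in> B") auto
  qed (use assms[OF B] in \<open>auto simp: indicator_def\<close>)
  ultimately show "?C \<longlonglongrightarrow> measure M A * measure M B"
    by (simp add: LIM_zero_iff)
qed

lemma centred_indicator_L_infinity:
  assumes [measurable]: "B \<in> sets M"
  shows "(\<lambda>x. complex_of_real (indicator B x - measure M B)) \<in> L_infinity M"
proof -
  have "esssup M (\<lambda>x. ereal (norm (complex_of_real (indicator B x - measure M B)))) \<le> 1"
  proof (rule esssup_I)
    have "\<bar>indicator B x - measure M B\<bar> \<le> 1" for x
      using prob_le_1[of B] measure_nonneg[of M B] by (cases "x \<in> B") auto
    then show "AE x in M. ereal (norm (complex_of_real (indicator B x - measure M B))) \<le> 1"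
      by (simp del: of_real_diff)
  qed measurable
  also have "\<dots> < \<infinity>" by simp
  finally show ?thesis by (simp add: L_infinity_def)
qed

end

theorem theorem1p13:
  fixes \<mu> M :: "real measure" and T :: "real \<Rightarrow> real"
  assumes "sets \<mu> = sets (restrict_space borel {0..1})"
    and "M = completion \<mu>"
    and "mps M T"
    and "\<And>f. \<lbrakk>f \<in> L_infinity M; (LINT x|M. f x) = 0\<rbrakk> \<Longrightarrow>
           \<exists>A. A \<in> sets M \<and> measure M A = 1 \<and>
             (\<forall>x\<in>A. strongly_mixing_sequence (\<lambda>n. f ((T ^^ n) x)))"
  shows "strongly_mixing M T"
proof -
  interpret mps M T by fact
  show ?thesis
  proof (rule strongly_mixing_if_centred_indicators)
    fix B assume B [measurable]: "B \<in> sets M"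
    let ?f = "\<lambda>x. complex_of_real (indicator B x - measure M B)"
    have "(LINT x|M. indicator B x - measure M B) = (0 :: real)"
      by (subst Bochner_Integration.integral_diff)
        (auto simp: integrable_real_indicator emeasure_eq_measure prob_space)
    then have "(LINT x|M. ?f x) = 0" by (simp only: integral_complex_of_real of_real_0)
    then obtain A where A: "A \<in> sets M" "measure M A = 1"
      and mixing: "\<And>x. x \<in> A \<Longrightarrow> strongly_mixing_sequence (\<lambda>n. ?f ((T ^^ n) x))"
      using assms(4)[OF centred_indicator_L_infinity[OF B]] by blast
    have "AE x in M. x \<in> A" using A by (simp add: prob_eq_1)
    then show "AE x in M. strongly_mixing_sequence (\<lambda>n. ?f ((T ^^ n) x))"
      by eventually_elim (rule mixing)
  qed
qed

end
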